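(* Let $f:\mathbb{R}^d\to\mathbb{R}$ be twice differentiable and $\mu$-strongly convex with $\mu>0$, and let $\nabla f$ be Lipschitz continuous with constant $L>0$. Let $\kappa=L/\mu$ and let $x_*$ be the minimizer of $f$. Let $\{x_t\}_{t\ge 0}$ be generated by BFGS, where at every iteration the step size satisfies the Armijo-Wolfe conditions with parameters $\alpha,\beta$, and let $x_0\in\mathbb{R}^d$ be an arbitrary initial point. (i) If $B_0=LI$, then for any $t\ge1$, $$\frac{f(x_t)-f(x_* )}{f(x_0)-f(x_* )}\le\left(1-\frac{2\alpha(1-\beta)}{\kappa}\right)^{t}.$$ (ii) If $B_0=\mu I$, then for any $t\ge1$, $$\frac{f(x_t)-f(x_* )}{f(x_0)-f(x_* )}\le\left(1-e^{-\frac{d\log\kappa}{t}}\frac{2\alpha(1-\beta)}{\kappa}\right)^{t};$$ moreover, for $t\ge d\log\kappa$ (with $t\ge 1$), $$\frac{f(x_t)-f(x_* )}{f(x_0)-f(x_* )}\le\left(1-\frac{2\alpha(1-\beta)}{3\kappa}\right)^{t}.$$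
   Context: BFGS method: given $x_0\in\mathbb{R}^d$ and a symmetric positive definite $B_0\in\mathbb{R}^{d\times d}$, for $t\ge0$ set $g_t=\nabla f(x_t)$, $d_t=-B_t^{-1}g_t$, $x_{t+1}=x_t+\eta_t d_t$ with step size $\eta_t>0$, $s_t=x_{t+1}-x_t$, $y_t=\nabla f(x_{t+1})-\nabla f(x_t)$, and $$B_{t+1}=B_t-\frac{B_ts_ts_t^\top B_t}{s_t^\top B_ts_t}+\frac{y_ty_t^\top}{s_t^\top y_t}.$$ The iterates are assumed non-optimal ($g_t\neq0$), so that all quantities are well defined. Armijo-Wolfe conditions on $\eta_t$, with parameters $0<\alpha<\beta<1$ and $0<\alpha<\frac12$: $$f(x_t+\eta_td_t)\le f(x_t)+\alpha\eta_t\nabla f(x_t)^\top d_t,\qquad \nabla f(x_t+\eta_td_t)^\top d_t\ge\beta\nabla f(x_t)^\top d_t.$$ *)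

theory Defs
  imports "HOL-Analysis.Analysis"
begin

text \<open>The description is meaningful only where \<open>f\<close> is differentiable, which is when the gradient
  exists and is unique (see \<open>GDERIV_grad\<close> below).\<close>

definition grad :: "('a::euclidean_space \<Rightarrow> real) \<Rightarrow> 'a \<Rightarrow> 'a" where
  "grad f x = (THE D. GDERIV f x :> D)"

lemma grad_eqI:
  assumes "GDERIV f x :> D"
  shows "grad f x = D"
  unfolding grad_def
proof (rule the_equality)
  fix D' assume "GDERIV f x :> D'"
  then have "(\<lambda>h. h \<bullet> D') = (\<lambda>h. h \<bullet> D)"
    using assms unfolding gderiv_def by (rule has_derivative_unique)
  then have "(D' - D) \<bullet> D' = (D' - D) \<bullet> D"
    by (rule fun_cong)
  then have "(D' - D) \<bullet> (D' - D) = 0"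
    unfolding inner_diff_right by simp
  then show "D' = D"
    by simp
qed (rule assms)

lemma GDERIV_grad:
  assumes "f differentiable (at x)"
  shows "GDERIV f x :> grad f x"
proof -
  from assms obtain f' where f': "(f has_derivative f') (at x)"
    unfolding differentiable_def by blast
  then have lin: "linear f'"
    by (rule has_derivative_linear)
  have "f' = (\<lambda>h. h \<bullet> adjoint f' 1)"
  proof
    fix h show "f' h = h \<bullet> adjoint f' 1"
      using adjoint_works[OF lin, of h 1] by simp
  qed
  with f' have "(f has_derivative (\<lambda>h. h \<bullet> adjoint f' 1)) (at x)"
    by simp
  then have "GDERIV f x :> adjoint f' 1"
    unfolding gderiv_def .
  then show ?thesis
    by (simp only: grad_eqI)
qed

definition twice_differentiable :: "('a::euclidean_space \<Rightarrow> real) \<Rightarrow> bool" where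
  "twice_differentiable f \<longleftrightarrow>
     (\<forall>x. f differentiable (at x)) \<and> (\<forall>x. grad f differentiable (at x))"

definition strongly_convex :: "real \<Rightarrow> ('a::euclidean_space \<Rightarrow> real) \<Rightarrow> bool" where
  "strongly_convex \<mu> f \<longleftrightarrow>
     (\<forall>x y. \<forall>u\<in>{0..1}.
        f (u *\<^sub>R x + (1 - u) *\<^sub>R y)
          \<le> u * f x + (1 - u) * f y - \<mu> / 2 * u * (1 - u) * (norm (x - y))\<^sup>2)"

definition sym_pos_def :: "real^'n^'n \<Rightarrow> bool" where
  "sym_pos_def A \<longleftrightarrow> transpose A = A \<and> (\<forall>v. v \<noteq> 0 \<longrightarrow> 0 < v \<bullet> (A *v v))"

definition outer :: "real^'n \<Rightarrow> real^'n \<Rightarrow> real^'n^'n" where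
  "outer u v = (\<chi> i j. u $ i * v $ j)"

definition bfgs_update :: "real^'n^'n \<Rightarrow> real^'n \<Rightarrow> real^'n \<Rightarrow> real^'n^'n" where
  "bfgs_update B s y =
     B - (1 / (s \<bullet> (B *v s))) *\<^sub>R (B ** outer s s ** B) + (1 / (s \<bullet> y)) *\<^sub>R outer y y"

definition bfgs_direction :: "(real^'n \<Rightarrow> real) \<Rightarrow> real^'n^'n \<Rightarrow> real^'n \<Rightarrow> real^'n" where
  "bfgs_direction f B x = - (matrix_inv B *v grad f x)"

text \<open>The initial data are \<open>x 0\<close> and \<open>B 0\<close>.  Non-optimality of all iterates is part of
  the notion; under it no denominator in the update vanishes in the strongly convex setting.\<close>

definition bfgs_sequence ::
  "(real^'n \<Rightarrow> real) \<Rightarrow> (nat \<Rightarrow> real^'n) \<Rightarrow> (nat \<Rightarrow> real^'n^'n) \<Rightarrow> (nat \<Rightarrow> real) \<Rightarrow> bool" where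
  "bfgs_sequence f x B \<eta> \<longleftrightarrow>
     sym_pos_def (B 0) \<and>
     (\<forall>t. grad f (x t) \<noteq> 0 \<and>
          0 < \<eta> t \<and>
          x (Suc t) = x t + \<eta> t *\<^sub>R bfgs_direction f (B t) (x t) \<and>
          B (Suc t) = bfgs_update (B t) (x (Suc t) - x t) (grad f (x (Suc t)) - grad f (x t)))"

definition armijo_wolfe ::
  "(real^'n \<Rightarrow> real) \<Rightarrow> real \<Rightarrow> real \<Rightarrow> real^'n \<Rightarrow> real^'n \<Rightarrow> real \<Rightarrow> bool" where
  "armijo_wolfe f \<alpha> \<beta> x d \<eta> \<longleftrightarrow>
     f (x + \<eta> *\<^sub>R d) \<le> f x + \<alpha> * \<eta> * (grad f x \<bullet> d) \<and>
     grad f (x + \<eta> *\<^sub>R d) \<bullet> d \<ge> \<beta> * (grad f x \<bullet> d)"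

end

theory Submission
  imports Defs
begin

text \<open>
  Write \<open>g\<^sub>t\<close>, \<open>s\<^sub>t\<close>, \<open>y\<^sub>t\<close> for the gradient, the step and the gradient difference at time \<open>t\<close>, and put
  \<open>r\<^sub>t = L (s\<^sub>t \<bullet> B\<^sub>t s\<^sub>t)\<^sup>2 / (\<bar>B\<^sub>t s\<^sub>t\<bar>\<^sup>2 (s\<^sub>t \<bullet> y\<^sub>t))\<close>.  Since \<open>B\<^sub>t s\<^sub>t\<close> is a multiple of \<open>g\<^sub>t\<close>, this is
  \<open>cos\<^sup>2 \<theta>\<^sub>t\<close> divided by the scaled curvature \<open>s\<^sub>t \<bullet> y\<^sub>t / (L \<bar>s\<^sub>t\<bar>\<^sup>2)\<close>, where \<open>\<theta>\<^sub>t\<close> is the angle between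
  the step and the steepest descent direction.

  One step contracts the gap \<open>f(x\<^sub>t) - f(x\<^sub>*)\<close> by the factor \<open>1 - c r\<^sub>t\<close> with
  \<open>c = 2 \<alpha> (1 - \<beta>) / \<kappa>\<close>: the Armijo condition turns \<open>- g\<^sub>t \<bullet> s\<^sub>t\<close> into decrease, the Wolfe
  condition bounds \<open>s\<^sub>t \<bullet> y\<^sub>t\<close> below by \<open>(1 - \<beta>) (- g\<^sub>t \<bullet> s\<^sub>t)\<close>, and strong convexity bounds
  \<open>\<bar>g\<^sub>t\<bar>\<^sup>2\<close> below by \<open>2 \<mu>\<close> times the gap (\<open>gap_Suc_le\<close>).  A single \<open>r\<^sub>t\<close> may be tiny; only the
  product of all of them is controlled, and it is controlled by the potential
  \<open>\<Psi>(B) = trace B / L - ln (det B)\<close>.  The update changes the trace and the determinant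
  explicitly, and because gradients of smooth convex functions are co-coercive, so that
  \<open>\<bar>y\<^sub>t\<bar>\<^sup>2 \<le> L (s\<^sub>t \<bullet> y\<^sub>t)\<close>, the inequality \<open>ln a \<le> a - 1\<close> gives
  \<open>\<Psi>(B\<^sub>t\<^sub>+\<^sub>1) \<le> \<Psi>(B\<^sub>t) + ln r\<^sub>t\<close> (\<open>bfgs_potential_update_le\<close>).
  On positive definite matrices \<open>\<Psi>\<close> is minimal at \<open>L I\<close> (\<open>bfgs_potential_ge\<close>), so the sum of the
  \<open>ln r\<^sub>i\<close> is at least \<open>\<Psi>(L I) - \<Psi>(B\<^sub>0)\<close>.  This is \<open>0\<close> for \<open>B\<^sub>0 = L I\<close> and at least
  \<open>- d ln \<kappa>\<close> for \<open>B\<^sub>0 = \<mu> I\<close>.  The inequality of arithmetic and geometric means converts that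
  bound into a bound for the product of the factors \<open>1 - c r\<^sub>i\<close> (\<open>prod_one_minus_le\<close>).
\<close>

section \<open>Rank-one matrices\<close>

lemma outer_mult_vec: "outer u v *v w = (v \<bullet> w) *\<^sub>R u"
  by (simp add: outer_def matrix_vector_mult_def inner_vec_def vec_eq_iff sum_distrib_left mult_ac)

lemma mult_outer: "M ** outer u v = outer (M *v u) v"
  by (simp add: outer_def matrix_vector_mult_def matrix_matrix_mult_def vec_eq_iff
      sum_distrib_left sum_distrib_right mult_ac)

lemma outer_mult: "outer u v ** M = outer u (transpose M *v v)"
  by (simp add: outer_def matrix_vector_mult_def matrix_matrix_mult_def transpose_def vec_eq_iff
      sum_distrib_left mult_ac)

lemma trace_outer: "trace (outer u v) = u \<bullet> v"
  by (simp add: trace_def outer_def inner_vec_def)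

lemma trace_scaleR: "trace (c *\<^sub>R A) = c * trace (A :: real^'n^'n)"
  by (simp add: trace_def sum_distrib_left)

text \<open>An orthogonal change of basis takes \<open>v\<close> to a multiple of a coordinate vector; the matrix then
  differs from the identity in one column only, and Cramer's rule reads off its determinant.\<close>

lemma det_mat_1_plus_outer:
  fixes u v :: "real^'n"
  shows "det (mat 1 + outer u v) = 1 + u \<bullet> v"
proof -
  define k :: 'n where "k = undefined"
  obtain f :: "real^'n \<Rightarrow> real^'n"
    where f: "orthogonal_transformation f" "f (norm v *\<^sub>R axis k 1) = v"
    by (rule orthogonal_transformation_exists[of "norm v *\<^sub>R axis k 1" v]) simp_all
  define Q where "Q = matrix f"
  have lin: "linear f" and orth: "orthogonal_matrix Q"
    using f(1) by (simp_all add: orthogonal_transformation_matrix Q_def)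
  have Qv: "Q *v (norm v *\<^sub>R axis k 1) = v"
    using f(2) lin by (simp add: Q_def)
  have QQ: "transpose Q ** Q = mat 1" "Q ** transpose Q = mat 1"
    using orth by (simp_all add: orthogonal_matrix_def)
  define c where "c = norm v"
  define w where "w = u v* Q"
  have vQ: "v v* Q = c *\<^sub>R axis k 1"
  proof -
    have "v v* Q = (transpose Q ** Q) *v (c *\<^sub>R axis k 1)"
      by (simp add: Qv c_def flip: matrix_vector_mul_assoc)
    then show ?thesis
      by (simp add: QQ)
  qed
  have add_mult: "(M + N) ** Q = M ** Q + N ** Q" for M N :: "real^'n^'n"
    by (simp add: matrix_matrix_mult_def vec_eq_iff sum.distrib distrib_right)
  have "transpose Q ** (mat 1 + outer u v) ** Q = mat 1 + outer w (c *\<^sub>R axis k 1)"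
    by (simp add: matrix_add_ldistrib add_mult QQ mult_outer outer_mult vQ w_def)
  also have "\<dots> = (\<chi> i j. if j = k then (mat 1 *v (axis k 1 + c *\<^sub>R w)) $ i
                           else mat 1 $ i $ j)"
    unfolding matrix_vector_mul_lid by (simp add: vec_eq_iff outer_def axis_def mat_def)
  finally have conj: "transpose Q ** (mat 1 + outer u v) ** Q
      = (\<chi> i j. if j = k then (mat 1 *v (axis k 1 + c *\<^sub>R w)) $ i else mat 1 $ i $ j)" .
  have "det (mat 1 + outer u v) = det (transpose Q ** (mat 1 + outer u v) ** Q)"
    using arg_cong[OF QQ(2), of det] by (simp add: det_mul)
  also have "\<dots> = 1 + c * w $ k"
    unfolding conj cramer_lemma by (simp add: axis_def)
  also have "c * w $ k = w \<bullet> (c *\<^sub>R axis k 1)"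
    using inner_axis[of w k 1] by simp
  also have "\<dots> = u \<bullet> v"
    unfolding w_def dot_lmul_matrix by (simp only: c_def Qv)
  finally show ?thesis .
qed

section \<open>The BFGS update\<close>

lemma sym_pos_def_inner_commute:
  assumes "sym_pos_def B"
  shows "u \<bullet> (B *v v) = (B *v u) \<bullet> v"
  using assms by (metis dot_lmul_matrix sym_pos_def_def transpose_matrix_vector)

lemma bfgs_update_eq:
  assumes "sym_pos_def B"
  shows "bfgs_update B s y = B - (1 / (s \<bullet> (B *v s))) *\<^sub>R outer (B *v s) (B *v s)
           + (1 / (s \<bullet> y)) *\<^sub>R outer y y"
  using assms by (simp add: bfgs_update_def mult_outer outer_mult sym_pos_def_def)

lemma bfgs_update_mult_vec:
  assumes "sym_pos_def B"
  shows "bfgs_update B s y *v w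
      = B *v w - ((B *v s) \<bullet> w / (s \<bullet> (B *v s))) *\<^sub>R (B *v s) + (y \<bullet> w / (s \<bullet> y)) *\<^sub>R y"
  by (simp add: bfgs_update_eq[OF assms] matrix_vector_mult_add_rdistrib
      matrix_vector_mult_diff_rdistrib outer_mult_vec flip: scaleR_matrix_vector_assoc)

lemma trace_bfgs_update:
  assumes "sym_pos_def B"
  shows "trace (bfgs_update B s y)
      = trace B - (norm (B *v s))\<^sup>2 / (s \<bullet> (B *v s)) + (norm y)\<^sup>2 / (s \<bullet> y)"
  by (simp add: bfgs_update_eq[OF assms] trace_add trace_sub trace_scaleR trace_outer
      power2_norm_eq_inner)

text \<open>The product form of the update.  It keeps positive definiteness visible, and since the factor
  \<open>A\<close> is a rank-one perturbation of the identity it also yields the determinant.\<close>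

lemma bfgs_update_factorization:
  fixes B :: "real^'n^'n"
  assumes B: "sym_pos_def B" and s: "s \<noteq> 0" and sy: "0 < s \<bullet> y"
  obtains A where "bfgs_update B s y = A ** B ** transpose A"
    and "det A ^ 2 = (s \<bullet> y) / (s \<bullet> (B *v s))"
proof -
  define q where "q = B *v s"
  define \<sigma> where "\<sigma> = s \<bullet> q"
  define \<rho> where "\<rho> = s \<bullet> y"
  have pos: "0 < \<sigma>" "0 < \<rho>"
    using B s sy by (simp_all add: sym_pos_def_def \<sigma>_def \<rho>_def q_def)
  define \<gamma> where "\<gamma> = sqrt (\<sigma> / \<rho>)"
  have \<gamma>2: "\<gamma> * \<gamma> = \<sigma> / \<rho>"
    using pos by (simp add: \<gamma>_def)
  define p where "p = \<gamma> *\<^sub>R y - q"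
  \<comment> \<open>In \<open>A B A\<^sup>T\<close> the cross terms complete a square: what is added to \<open>B\<close> is
    \<open>((p + q)(p + q)\<^sup>T - q q\<^sup>T) / \<sigma>\<close> with \<open>p + q = \<gamma> y\<close>, so \<open>\<gamma>\<^sup>2 = \<sigma> / \<rho>\<close> is forced.\<close>
  define A where "A = mat 1 + outer ((1 / \<sigma>) *\<^sub>R p) s"
  have Av: "A *v w = w + (s \<bullet> w / \<sigma>) *\<^sub>R p" for w
    by (simp add: A_def matrix_vector_mult_add_rdistrib outer_mult_vec)
  have tA: "transpose A = mat 1 + outer s ((1 / \<sigma>) *\<^sub>R p)"
    by (simp add: A_def transpose_def outer_def vec_eq_iff mat_def mult_ac)
  have Atv: "transpose A *v w = w + (p \<bullet> w / \<sigma>) *\<^sub>R s" for w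
    by (simp add: tA matrix_vector_mult_add_rdistrib outer_mult_vec)
  have "bfgs_update B s y *v w = (A ** B ** transpose A) *v w" for w
  proof -
    define a where "a = p \<bullet> w / \<sigma>"
    define b where "b = q \<bullet> w / \<sigma>"
    have a: "a = \<gamma> * (y \<bullet> w) / \<sigma> - b"
      by (simp add: a_def b_def p_def inner_diff_left diff_divide_distrib)
    have sBw: "s \<bullet> (B *v w) = q \<bullet> w"
      using B by (simp add: sym_pos_def_inner_commute q_def)
    have "(A ** B ** transpose A) *v w = A *v (B *v w + a *\<^sub>R q)"
      by (simp add: Atv matrix_vector_mult_scaleR matrix_vector_right_distrib q_def a_def
          del: transpose_matrix_vector flip: matrix_vector_mul_assoc)
    also have "\<dots> = B *v w + a *\<^sub>R q + (b + a) *\<^sub>R p"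
      using pos by (simp add: Av inner_add_right sBw b_def flip: \<sigma>_def) (simp add: add_divide_distrib)
    also have "\<dots> = B *v w - b *\<^sub>R q + (\<gamma> * \<gamma> * (y \<bullet> w) / \<sigma>) *\<^sub>R y"
      by (simp add: a p_def algebra_simps)
    also have "\<dots> = B *v w - b *\<^sub>R q + (y \<bullet> w / \<rho>) *\<^sub>R y"
      using pos by (simp add: \<gamma>2)
    also have "\<dots> = bfgs_update B s y *v w"
      by (simp add: bfgs_update_mult_vec[OF B] b_def \<sigma>_def \<rho>_def q_def)
    finally show ?thesis by simp
  qed
  then have "bfgs_update B s y = A ** B ** transpose A"
    by (simp add: matrix_eq)
  moreover have "det A ^ 2 = \<rho> / \<sigma>"
  proof -
    have "det A = 1 + (p \<bullet> s) / \<sigma>"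
      by (simp add: A_def det_mat_1_plus_outer)
    also have "\<dots> = \<gamma> * \<rho> / \<sigma>"
      using pos by (simp add: p_def inner_diff_left inner_diff_right inner_commute[of _ s]
          diff_divide_distrib
          flip: \<sigma>_def \<rho>_def)
    finally have "det A ^ 2 = (\<gamma> * \<gamma>) * \<rho>\<^sup>2 / \<sigma>\<^sup>2"
      by (simp add: power2_eq_square)
    then show ?thesis
      using pos by (simp add: \<gamma>2 power2_eq_square)
  qed
  ultimately show thesis
    using that by (simp add: \<sigma>_def \<rho>_def q_def)
qed

lemma det_bfgs_update:
  assumes "sym_pos_def B" "s \<noteq> 0" "0 < s \<bullet> y"
  shows "det (bfgs_update B s y) = det B * ((s \<bullet> y) / (s \<bullet> (B *v s)))"
proof -
  obtain A where A: "bfgs_update B s y = A ** B ** transpose A"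
    "det A ^ 2 = (s \<bullet> y) / (s \<bullet> (B *v s))"
    by (rule bfgs_update_factorization[OF assms])
  show ?thesis
    by (simp add: A(1) det_mul flip: A(2)) (simp add: power2_eq_square)
qed

lemma sym_pos_def_bfgs_update:
  assumes B: "sym_pos_def B" and s: "s \<noteq> 0" and sy: "0 < s \<bullet> y"
  shows "sym_pos_def (bfgs_update B s y)"
proof -
  obtain A where A: "bfgs_update B s y = A ** B ** transpose A"
    "det A ^ 2 = (s \<bullet> y) / (s \<bullet> (B *v s))"
    by (rule bfgs_update_factorization[OF assms])
  have "0 < s \<bullet> (B *v s)"
    using B s by (simp add: sym_pos_def_def)
  then have "det A \<noteq> 0"
    using sy A(2) by auto
  then have inj: "inj ((*v) (transpose A))"
    using transpose_invertible[of A] inj_matrix_vector_mult[of "transpose A"] invertible_det_nz[of A]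
    by blast
  have "0 < v \<bullet> ((A ** B ** transpose A) *v v)" if "v \<noteq> 0" for v
  proof -
    have "transpose A *v v \<noteq> 0"
      using inj that by (metis injD matrix_vector_mult_0_right)
    then have "0 < (transpose A *v v) \<bullet> (B *v (transpose A *v v))"
      using B by (simp add: sym_pos_def_def)
    also have "\<dots> = v \<bullet> ((A ** B ** transpose A) *v v)"
      by (metis dot_lmul_matrix matrix_vector_mul_assoc transpose_matrix_vector transpose_transpose)
    finally show ?thesis .
  qed
  moreover have "transpose (A ** B ** transpose A) = A ** B ** transpose A"
    using B by (simp add: sym_pos_def_def matrix_transpose_mul matrix_mul_assoc)
  ultimately show ?thesis
    by (simp add: A(1) sym_pos_def_def)
qed

section \<open>The potential function\<close>

text \<open>Up to an additive constant this is the log-det (Stein) divergence of \<open>B\<close> from \<open>L I\<close>, that is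
  \<open>trace (B / L) - ln (det (B / L)) - d\<close>.  The constant cancels in every comparison below.\<close>

definition bfgs_potential :: "real \<Rightarrow> real^'n^'n \<Rightarrow> real" where
  "bfgs_potential L B = trace B / L - ln (det B)"

text \<open>With \<open>a = \<bar>B s\<bar>\<^sup>2 / (L (s \<bullet> B s))\<close>, the trace term falls by \<open>a\<close> and rises by at most \<open>1\<close>.
  The argument of the logarithm on the right is the inverse determinant ratio divided by \<open>a\<close>, so
  what remains is \<open>ln a \<le> a - 1\<close>.\<close>

lemma bfgs_potential_update_le:
  fixes B :: "real^'n^'n"
  assumes B: "sym_pos_def B" "0 < det B" and s: "s \<noteq> 0" and sy: "0 < s \<bullet> y"
    and L: "0 < L" and y: "(norm y)\<^sup>2 \<le> L * (s \<bullet> y)"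
  shows "bfgs_potential L (bfgs_update B s y)
    \<le> bfgs_potential L B + ln (L * (s \<bullet> (B *v s))\<^sup>2 / ((norm (B *v s))\<^sup>2 * (s \<bullet> y)))"
proof -
  define \<sigma> where "\<sigma> = s \<bullet> (B *v s)"
  define \<rho> where "\<rho> = s \<bullet> y"
  define a where "a = (norm (B *v s))\<^sup>2 / (L * \<sigma>)"
  have pos: "0 < \<sigma>" "0 < \<rho>"
    using B s sy by (simp_all add: sym_pos_def_def \<sigma>_def \<rho>_def)
  have "B *v s \<noteq> 0"
    using pos by (auto simp: \<sigma>_def)
  then have a: "0 < a" and nz: "norm (B *v s) > 0"
    using pos L by (simp_all add: a_def)
  have "(norm y)\<^sup>2 / (L * \<rho>) \<le> 1"
    using y L pos by (simp add: \<rho>_def)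
  moreover have "trace (bfgs_update B s y) / L = trace B / L - a + (norm y)\<^sup>2 / (L * \<rho>)"
    by (simp add: trace_bfgs_update[OF B(1)] a_def \<sigma>_def \<rho>_def add_divide_distrib
        diff_divide_distrib mult.commute)
  moreover have "ln (det (bfgs_update B s y)) = ln (det B) + ln (\<rho> / \<sigma>)"
    using B pos ln_mult_pos[of "det B" "\<rho> / \<sigma>"]
    by (simp add: det_bfgs_update s sy flip: \<sigma>_def \<rho>_def)
  moreover have "ln a \<le> a - 1"
    using a by (rule ln_le_minus_one)
  moreover have "ln (\<sigma> / \<rho> / a) = - ln (\<rho> / \<sigma>) - ln a"
    using pos a by (simp add: ln_div ln_mult_pos)
  moreover have "L * \<sigma>\<^sup>2 / ((norm (B *v s))\<^sup>2 * \<rho>) = \<sigma> / \<rho> / a"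
    using pos L nz by (simp add: a_def power2_eq_square mult_ac)
  ultimately show ?thesis
    unfolding \<sigma>_def[symmetric] \<rho>_def[symmetric] bfgs_potential_def by simp
qed

lemma det_scaleR_mat_1: "det (c *\<^sub>R mat 1 :: real^'n^'n) = c ^ CARD('n)"
  by (subst det_diagonal) (auto simp: mat_def)

lemma bfgs_potential_scaleR_mat_1:
  assumes "0 < c"
  shows "bfgs_potential L (c *\<^sub>R mat 1 :: real^'n^'n) = CARD('n) * (c / L - ln c)"
  using assms by (simp add: bfgs_potential_def det_scaleR_mat_1 trace_scaleR trace_I ln_realpow
      algebra_simps)

text \<open>The BFGS update itself proves the lower bound, without eigenvalues.  Updating \<open>B\<close> along each
  coordinate vector \<open>s\<close> in turn with \<open>y = L s\<close> (the exact secant pair of the Hessian \<open>L I\<close>)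
  never increases the potential, preserves the secant equations obtained earlier, and therefore
  ends at \<open>L I\<close>.  The determinant only picks up positive factors on the way, so it was
  positive at the start.  The induction is on a set that contains every coordinate direction on
  which \<open>B\<close> does not yet act as \<open>L I\<close>.\<close>

lemma bfgs_potential_ge:
  fixes B :: "real^'n^'n"
  assumes B: "sym_pos_def B" and L: "0 < L"
  shows "0 < det B \<and> bfgs_potential L (L *\<^sub>R mat 1 :: real^'n^'n) \<le> bfgs_potential L B"
proof -
  have "0 < det B \<and> bfgs_potential L (L *\<^sub>R mat 1 :: real^'n^'n) \<le> bfgs_potential L B"
    if "finite S" "sym_pos_def B" "\<And>i. i \<notin> S \<Longrightarrow> B *v axis i 1 = L *\<^sub>R axis i 1"
    for S and B :: "real^'n^'n"
    using that
  proof (induction S arbitrary: B rule: finite_induct)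
    case empty
    have "B $ i $ j = (L *\<^sub>R mat 1) $ i $ j" for i j
    proof -
      have "B $ i $ j = (B *v axis j 1) $ i"
        by (simp add: matrix_vector_mult_basis column_def)
      also have "\<dots> = (L *\<^sub>R mat 1) $ i $ j"
        using empty by (simp add: mat_def axis_def)
      finally show ?thesis .
    qed
    then have "B = L *\<^sub>R mat 1"
      by (simp add: vec_eq_iff)
    with L show ?case
      by (simp add: det_scaleR_mat_1)
  next
    case (insert j S)
    define s :: "real^'n" where "s = axis j 1"
    define \<sigma> where "\<sigma> = s \<bullet> (B *v s)"
    define B' where "B' = bfgs_update B s (L *\<^sub>R s)"
    have s: "s \<noteq> 0" "norm s = 1" "s \<bullet> s = 1"
      by (simp_all add: s_def inner_axis_axis)
    have sy: "0 < s \<bullet> (L *\<^sub>R s)"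
      using L s by simp
    have \<sigma>: "0 < \<sigma>"
      using insert.prems(1) s by (simp add: \<sigma>_def sym_pos_def_def)
    have fixed: "B' *v axis i 1 = L *\<^sub>R axis i 1" if "i \<notin> S" for i
    proof (cases "i = j")
      case True
      have "(B *v s) \<bullet> s = \<sigma>"
        by (simp add: \<sigma>_def inner_commute)
      then have "B' *v s = L *\<^sub>R s"
        using \<sigma> L s(3)
        unfolding B'_def bfgs_update_mult_vec[OF insert.prems(1)] \<sigma>_def[symmetric] by simp
      then show ?thesis
        by (simp add: True s_def)
    next
      case False
      then have "B *v axis i 1 = L *\<^sub>R axis i 1" and "s \<bullet> axis i 1 = 0"
        using that insert.prems(2) by (auto simp: s_def inner_axis_axis)
      then show ?thesis
        using sym_pos_def_inner_commute[OF insert.prems(1), of s "axis i 1"]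
        by (simp add: B'_def bfgs_update_mult_vec[OF insert.prems(1)])
    qed
    have IH: "0 < det B' \<and> bfgs_potential L (L *\<^sub>R mat 1 :: real^'n^'n) \<le> bfgs_potential L B'"
      using insert.IH[OF _ fixed] sym_pos_def_bfgs_update[OF insert.prems(1) s(1) sy]
      by (simp add: B'_def)
    have "det B' = det B * (L / \<sigma>)"
      by (simp add: B'_def det_bfgs_update[OF insert.prems(1) s(1) sy] s \<sigma>_def)
    with IH L \<sigma> have detB: "0 < det B"
      by (simp add: zero_less_mult_iff zero_less_divide_iff)
    have "\<sigma> \<le> norm (B *v s)"
      using norm_cauchy_schwarz[of s "B *v s"] s by (simp add: \<sigma>_def)
    then have "\<sigma>\<^sup>2 \<le> (norm (B *v s))\<^sup>2"
      using \<sigma> by (simp add: power_mono)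
    moreover have "0 < \<sigma>\<^sup>2" "B *v s \<noteq> 0"
      using \<sigma> by (auto simp: \<sigma>_def)
    ultimately have "\<sigma>\<^sup>2 / (norm (B *v s))\<^sup>2 \<le> 1" "0 < \<sigma>\<^sup>2 / (norm (B *v s))\<^sup>2"
      by (simp_all add: divide_le_eq zero_less_divide_iff)
    then have "ln (\<sigma>\<^sup>2 / (norm (B *v s))\<^sup>2) \<le> 0"
      by simp
    moreover have "bfgs_potential L B' \<le> bfgs_potential L B + ln (\<sigma>\<^sup>2 / (norm (B *v s))\<^sup>2)"
      using bfgs_potential_update_le[OF insert.prems(1) detB s(1) sy L] L s
      by (simp add: B'_def \<sigma>_def power2_eq_square)
    ultimately show ?case
      using IH detB by simp
  qed
  from this[of UNIV B] show ?thesis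
    using B by simp
qed

section \<open>From the sum of logarithms to the product of contraction factors\<close>

text \<open>The arithmetic mean of the \<open>r i\<close> is at least their geometric mean, which is at least
  \<open>R = exp (- K / t)\<close>; the geometric mean of the \<open>1 - c * r i\<close> is at most their arithmetic
  mean, which is then at most \<open>1 - c * R\<close>.\<close>

lemma prod_one_minus_le:
  fixes r :: "nat \<Rightarrow> real"
  assumes t: "1 \<le> t" and c: "0 \<le> c"
    and r: "\<And>i. 0 < r i" "\<And>i. c * r i \<le> 1"
    and K: "- K \<le> (\<Sum>i<t. ln (r i))"
  shows "(\<Prod>i<t. 1 - c * r i) \<le> (1 - c * exp (- (K / t))) ^ t"
proof -
  define R where "R = exp (- (K / t))"
  have R: "0 < R" "ln R = - (K / t)"
    by (simp_all add: R_def)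
  \<comment> \<open>The tangent line of the exponential function at \<open>ln R\<close>, evaluated at \<open>ln (r i)\<close>.\<close>
  have "R * (1 - ln R + ln (r i)) \<le> r i" for i
  proof -
    have "ln (r i / R) \<le> r i / R - 1"
      using r(1)[of i] R(1) by (intro ln_le_minus_one) simp
    then have "1 - ln R + ln (r i) \<le> r i / R"
      using r(1)[of i] R(1) by (simp add: ln_div)
    then show ?thesis
      using R(1) by (simp add: pos_le_divide_eq mult.commute)
  qed
  then have "(\<Sum>i<t. R * (1 - ln R + ln (r i))) \<le> (\<Sum>i<t. r i)"
    by (rule sum_mono)
  moreover have "(\<Sum>i<t. R * (1 - ln R + ln (r i))) = R * (t + K + (\<Sum>i<t. ln (r i)))"
    using t by (simp add: R(2) sum.distrib flip: sum_distrib_left) (simp add: field_simps)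
  moreover have "R * t \<le> R * (t + K + (\<Sum>i<t. ln (r i)))"
    using K R(1) by (intro mult_left_mono) auto
  ultimately have "R * t \<le> (\<Sum>i<t. r i)"
    by linarith
  then have "c * (R * t) \<le> c * (\<Sum>i<t. r i)"
    using c by (rule mult_left_mono)
  then have mean: "(\<Sum>i<t. (1 - c * r i) / t) \<le> 1 - c * R"
    using t by (simp add: sum_subtractf flip: sum_divide_distrib sum_distrib_left)
      (simp add: field_simps)
  define P where "P = (\<Prod>i<t. 1 - c * r i)"
  have P: "0 \<le> P"
    using r(2) by (simp add: P_def prod_nonneg)
  have "P powr (1 / t) \<le> (\<Sum>i<t. (1 - c * r i) / t)"
    using arith_geom_mean[of "{..<t}" "\<lambda>i. 1 - c * r i"] t r(2)
    by (simp add: P_def lessThan_empty_iff)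
  with mean have "P powr (1 / t) \<le> 1 - c * R"
    by linarith
  then have "(P powr (1 / t)) ^ t \<le> (1 - c * R) ^ t"
    by (rule power_mono) simp
  moreover have "(P powr (1 / t)) ^ t = P"
    using t P by (cases "P = 0") (simp_all add: powr_power)
  ultimately show ?thesis
    by (simp add: P_def R_def)
qed

section \<open>Smooth strongly convex functions\<close>

lemma has_real_derivative_along_line:
  fixes f :: "'a::euclidean_space \<Rightarrow> real"
  assumes "f differentiable (at (x + u *\<^sub>R d))"
  shows "((\<lambda>u. f (x + u *\<^sub>R d)) has_real_derivative grad f (x + u *\<^sub>R d) \<bullet> d) (at u)"
proof -
  have "(f has_derivative (\<lambda>h. h \<bullet> grad f (x + u *\<^sub>R d))) (at (x + u *\<^sub>R d))"
    using GDERIV_grad[OF assms] by (simp add: gderiv_def)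
  moreover have "((\<lambda>u. x + u *\<^sub>R d) has_derivative (\<lambda>h. h *\<^sub>R d)) (at u)"
    by (auto intro!: derivative_eq_intros)
  ultimately have "((\<lambda>u. f (x + u *\<^sub>R d)) has_derivative
      (\<lambda>h. (h *\<^sub>R d) \<bullet> grad f (x + u *\<^sub>R d))) (at u)"
    using has_derivative_compose by blast
  then show ?thesis
    by (rule has_derivative_imp_has_field_derivative) (simp add: inner_commute mult.commute)
qed

text \<open>On the segment from \<open>x\<close> to \<open>y\<close>, strong convexity bounds the difference quotients of \<open>f\<close> at
  \<open>x\<close>; the claim is their limit as the segment parameter tends to \<open>0\<close>.\<close>

lemma strongly_convex_lower_bound:
  fixes f :: "'a::euclidean_space \<Rightarrow> real"
  assumes diff: "\<And>x. f differentiable (at x)" and sc: "strongly_convex \<mu> f"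
  shows "f x + grad f x \<bullet> (y - x) + \<mu> / 2 * (norm (y - x))\<^sup>2 \<le> f y"
proof -
  define N where "N = \<mu> / 2 * (norm (y - x))\<^sup>2"
  have "((\<lambda>u. f (x + u *\<^sub>R (y - x))) has_real_derivative grad f x \<bullet> (y - x)) (at 0)"
    using has_real_derivative_along_line[OF diff, of x "y - x" 0] by simp
  then have "((\<lambda>u. (f (x + u *\<^sub>R (y - x)) - f x) / u) \<longlongrightarrow> grad f x \<bullet> (y - x)) (at_right 0)"
    by (simp add: has_field_derivative_iff filterlim_at_split)
  moreover have "((\<lambda>u. f y - f x - N * (1 - u)) \<longlongrightarrow> f y - f x - N * (1 - 0)) (at_right 0)"
    by (intro tendsto_intros)
  moreover have "eventually (\<lambda>u. (f (x + u *\<^sub>R (y - x)) - f x) / u \<le> f y - f x - N * (1 - u))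
      (at_right (0::real))"
  proof -
    have "(f (x + u *\<^sub>R (y - x)) - f x) / u \<le> f y - f x - N * (1 - u)" if u: "0 < u" "u < 1" for u
    proof -
      have "u *\<^sub>R y + (1 - u) *\<^sub>R x = x + u *\<^sub>R (y - x)"
        by (simp add: algebra_simps)
      moreover have "f (u *\<^sub>R y + (1 - u) *\<^sub>R x)
          \<le> u * f y + (1 - u) * f x - \<mu> / 2 * u * (1 - u) * (norm (y - x))\<^sup>2"
        using sc u unfolding strongly_convex_def by simp
      ultimately have "f (x + u *\<^sub>R (y - x)) - f x \<le> u * (f y - f x - N * (1 - u))"
        by (simp add: N_def algebra_simps)
      then show ?thesis
        using u by (simp add: pos_divide_le_eq mult.commute)
    qed
    then show ?thesis
      unfolding eventually_at_right_field by (intro exI[of _ 1]) auto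
  qed
  ultimately have "grad f x \<bullet> (y - x) \<le> f y - f x - N * (1 - 0)"
    by (intro tendsto_le[of "at_right (0::real)"]) auto
  then show ?thesis
    by (simp add: N_def)
qed

text \<open>The Polyak-Lojasiewicz inequality: minimise the quadratic lower bound at \<open>x\<close> over all target
  points.\<close>

lemma strongly_convex_gradient_dominance:
  fixes f :: "'a::euclidean_space \<Rightarrow> real"
  assumes diff: "\<And>x. f differentiable (at x)" and sc: "strongly_convex \<mu> f" and \<mu>: "0 < \<mu>"
  shows "2 * \<mu> * (f x - f y) \<le> (norm (grad f x))\<^sup>2"
proof -
  define g where "g = grad f x"
  define v where "v = y - x"
  have "0 \<le> (norm (g + \<mu> *\<^sub>R v))\<^sup>2"
    by simp
  also have "\<dots> = (norm g)\<^sup>2 + 2 * \<mu> * (g \<bullet> v + \<mu> / 2 * (norm v)\<^sup>2)"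
    by (simp add: power2_norm_eq_inner inner_add_left inner_add_right inner_commute algebra_simps)
  also have "\<dots> \<le> (norm g)\<^sup>2 + 2 * \<mu> * (f y - f x)"
    using strongly_convex_lower_bound[OF diff sc, of x y] \<mu>
    by (intro add_left_mono mult_left_mono) (auto simp: g_def v_def)
  finally show ?thesis
    by (simp add: g_def algebra_simps)
qed

lemma strongly_convex_gradient_monotone:
  fixes f :: "'a::euclidean_space \<Rightarrow> real"
  assumes diff: "\<And>x. f differentiable (at x)" and sc: "strongly_convex \<mu> f"
  shows "\<mu> * (norm (y - x))\<^sup>2 \<le> (y - x) \<bullet> (grad f y - grad f x)"
  using strongly_convex_lower_bound[OF diff sc, of x y]
    strongly_convex_lower_bound[OF diff sc, of y x]
  by (simp add: norm_minus_commute inner_diff_left inner_diff_right inner_commute field_simps)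

text \<open>Subtracting the quadratic upper model along the segment leaves a function \<open>\<psi>\<close> with nonpositive
  derivative.\<close>

lemma lipschitz_gradient_upper_bound:
  fixes f :: "'a::euclidean_space \<Rightarrow> real"
  assumes diff: "\<And>x. f differentiable (at x)" and lip: "L-lipschitz_on UNIV (grad f)"
  shows "f y \<le> f x + grad f x \<bullet> (y - x) + L / 2 * (norm (y - x))\<^sup>2"
proof -
  define d where "d = y - x"
  define \<psi> where "\<psi> u = f (x + u *\<^sub>R d) - u * (grad f x \<bullet> d) - L / 2 * (norm d)\<^sup>2 * u\<^sup>2" for u
  have "\<psi> 1 \<le> \<psi> 0"
  proof (rule DERIV_nonpos_imp_nonincreasing[where f = \<psi>])
    fix u :: real
    assume u: "0 \<le> u" "u \<le> 1"
    let ?D = "grad f (x + u *\<^sub>R d) \<bullet> d - grad f x \<bullet> d - L * u * (norm d)\<^sup>2"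
    have "(\<psi> has_real_derivative ?D) (at u)"
      unfolding \<psi>_def using has_real_derivative_along_line[OF diff, of x d u]
      by (auto intro!: derivative_eq_intros)
    moreover have "?D \<le> 0"
    proof -
      have "(grad f (x + u *\<^sub>R d) - grad f x) \<bullet> d \<le> norm (grad f (x + u *\<^sub>R d) - grad f x) * norm d"
        by (rule norm_cauchy_schwarz)
      also have "\<dots> \<le> L * norm (u *\<^sub>R d) * norm d"
        using lipschitz_onD[OF lip, of "x + u *\<^sub>R d" x] by (intro mult_right_mono) (auto simp: dist_norm)
      finally show ?thesis
        using u by (simp add: inner_diff_left power2_eq_square mult_ac)
    qed
    ultimately show "\<exists>D. (\<psi> has_real_derivative D) (at u) \<and> D \<le> 0"
      by blast
  qed simp
  then show ?thesis
    by (simp add: \<psi>_def d_def)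
qed

text \<open>The function \<open>f - grad f x \<bullet> _\<close> is convex with minimum at \<open>x\<close>.  Its value at \<open>x\<close> is therefore at
  most its value after one gradient step of length \<open>1 / L\<close> from \<open>y\<close>, and the quadratic upper
  bound says how much that step gains.\<close>

lemma convex_lipschitz_gradient_lower_bound:
  fixes f :: "'a::euclidean_space \<Rightarrow> real"
  assumes diff: "\<And>x. f differentiable (at x)" and lip: "L-lipschitz_on UNIV (grad f)" and L: "0 < L"
    and cvx: "\<And>x y. f x + grad f x \<bullet> (y - x) \<le> f y"
  shows "f x + grad f x \<bullet> (y - x) + (norm (grad f y - grad f x))\<^sup>2 / (2 * L) \<le> f y"
proof -
  define v where "v = grad f y - grad f x"
  define z where "z = y - (1 / L) *\<^sub>R v"
  have "f x + grad f x \<bullet> (z - x) \<le> f z"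
    by (rule cvx)
  also have "\<dots> \<le> f y + grad f y \<bullet> (z - y) + L / 2 * (norm (z - y))\<^sup>2"
    by (rule lipschitz_gradient_upper_bound[OF diff lip])
  also have "L / 2 * (norm (z - y))\<^sup>2 = (norm v)\<^sup>2 / (2 * L)"
    using L by (simp add: z_def power2_eq_square)
  finally have "f x + grad f x \<bullet> (y - x) \<le> f y - (1 / L) * (v \<bullet> v) + (norm v)\<^sup>2 / (2 * L)"
    by (simp add: z_def v_def inner_diff_left inner_diff_right diff_divide_distrib)
  moreover have "(1 / L) * (v \<bullet> v) = 2 * ((norm v)\<^sup>2 / (2 * L))"
    by (simp add: power2_norm_eq_inner)
  ultimately show ?thesis
    unfolding v_def by linarith
qed

text \<open>The theorem of Baillon and Haddad: add the preceding inequality to the one with \<open>x\<close> and \<open>y\<close>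
  exchanged.\<close>

lemma convex_lipschitz_gradient_cocoercive:
  fixes f :: "'a::euclidean_space \<Rightarrow> real"
  assumes diff: "\<And>x. f differentiable (at x)" and lip: "L-lipschitz_on UNIV (grad f)" and L: "0 < L"
    and cvx: "\<And>x y. f x + grad f x \<bullet> (y - x) \<le> f y"
  shows "(norm (grad f y - grad f x))\<^sup>2 \<le> L * ((y - x) \<bullet> (grad f y - grad f x))"
proof -
  define N where "N = (norm (grad f y - grad f x))\<^sup>2"
  have "f x + grad f x \<bullet> (y - x) + N / (2 * L) \<le> f y"
    "f y + grad f y \<bullet> (x - y) + N / (2 * L) \<le> f x"
    using convex_lipschitz_gradient_lower_bound[OF diff lip L cvx, of x y]
      convex_lipschitz_gradient_lower_bound[OF diff lip L cvx, of y x]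
    by (simp_all add: N_def norm_minus_commute)
  then have "2 * (N / (2 * L)) \<le> (y - x) \<bullet> (grad f y - grad f x)"
    by (simp add: inner_diff_left inner_diff_right inner_commute)
  then show ?thesis
    using L by (simp add: N_def pos_divide_le_eq mult.commute)
qed

text \<open>Hence the condition number is at least one.\<close>

lemma strong_convexity_le_lipschitz_gradient:
  fixes f :: "'a::euclidean_space \<Rightarrow> real"
  assumes diff: "\<And>x. f differentiable (at x)" and sc: "strongly_convex \<mu> f"
    and lip: "L-lipschitz_on UNIV (grad f)"
  shows "\<mu> \<le> L"
proof -
  obtain b :: 'a where b: "norm b = 1"
    using vector_choose_size[of 1] by auto
  have "\<mu> \<le> b \<bullet> (grad f b - grad f 0)"
    using strongly_convex_gradient_monotone[OF diff sc, of b 0] b by simp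
  also have "\<dots> \<le> norm b * norm (grad f b - grad f 0)"
    by (rule norm_cauchy_schwarz)
  also have "\<dots> \<le> L"
    using lipschitz_onD[OF lip, of b 0] b by (simp add: dist_norm)
  finally show ?thesis .
qed

section \<open>Convergence of BFGS\<close>

locale bfgs_armijo_wolfe =
  fixes f :: "real^'n \<Rightarrow> real" and x :: "nat \<Rightarrow> real^'n" and B :: "nat \<Rightarrow> real^'n^'n"
    and \<eta> :: "nat \<Rightarrow> real" and x_star :: "real^'n" and \<mu> L \<alpha> \<beta> :: real
  assumes diff: "\<And>z. f differentiable (at z)"
    and \<mu>: "0 < \<mu>" and sc: "strongly_convex \<mu> f"
    and L: "0 < L" and lip: "L-lipschitz_on UNIV (grad f)"
    and min: "\<And>z. f x_star \<le> f z"
    and \<alpha>: "0 < \<alpha>" and \<beta>: "\<beta> < 1"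
    and seq: "bfgs_sequence f x B \<eta>"
    and aw: "\<And>t. armijo_wolfe f \<alpha> \<beta> (x t) (bfgs_direction f (B t) (x t)) (\<eta> t)"
begin

definition s :: "nat \<Rightarrow> real^'n" where "s t = x (Suc t) - x t"

definition y :: "nat \<Rightarrow> real^'n" where "y t = grad f (x (Suc t)) - grad f (x t)"

text \<open>The squared cosine of the angle between \<open>s t\<close> and the negative gradient, divided by
  \<open>(s t \<bullet> y t) / (L * (norm (s t))\<^sup>2)\<close>; the norm of \<open>s t\<close> cancels.\<close>

definition r :: "nat \<Rightarrow> real" where
  "r t = L * (s t \<bullet> (B t *v s t))\<^sup>2 / ((norm (B t *v s t))\<^sup>2 * (s t \<bullet> y t))"

lemma B_Suc: "B (Suc t) = bfgs_update (B t) (s t) (y t)"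
  using seq by (simp add: bfgs_sequence_def s_def y_def)

lemma s_eq: "s t = \<eta> t *\<^sub>R bfgs_direction f (B t) (x t)"
  using seq by (simp add: bfgs_sequence_def s_def)

lemma grad_nonzero: "grad f (x t) \<noteq> 0" and step_pos: "0 < \<eta> t"
  using seq by (simp_all add: bfgs_sequence_def)

lemma B_mult_s:
  assumes "sym_pos_def (B t)"
  shows "B t *v s t = - (\<eta> t *\<^sub>R grad f (x t))"
proof -
  have "invertible (B t)"
    using bfgs_potential_ge[OF assms L] by (simp add: invertible_det_nz)
  then have "B t ** matrix_inv (B t) = mat 1"
    unfolding invertible_def matrix_inv_def by (rule someI2_ex) simp
  then show ?thesis
    by (simp add: s_eq bfgs_direction_def matrix_vector_mult_scaleR matrix_vector_mul_assoc
        vec.neg)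
qed

lemma s_nonzero:
  assumes "sym_pos_def (B t)"
  shows "s t \<noteq> 0"
  using B_mult_s[OF assms] grad_nonzero[of t] step_pos[of t] by auto

lemma curvature_pos:
  assumes "sym_pos_def (B t)"
  shows "0 < s t \<bullet> y t"
proof -
  have "0 < \<mu> * (norm (s t))\<^sup>2"
    using s_nonzero[OF assms] \<mu> by simp
  also have "\<dots> \<le> s t \<bullet> y t"
    unfolding s_def y_def by (rule strongly_convex_gradient_monotone[OF diff sc])
  finally show ?thesis .
qed

text \<open>Positive definiteness of \<open>B t\<close> is what makes the step at time \<open>t\<close> nonzero, and strong convexity
  then makes its curvature positive, as the next update requires.  This is why the preceding
  facts are stated for a \<open>B t\<close> assumed positive definite.\<close>

lemma B_sym_pos_def: "sym_pos_def (B t)"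
proof (induction t)
  case 0
  then show ?case
    using seq by (simp add: bfgs_sequence_def)
next
  case (Suc t)
  then show ?case
    by (simp add: B_Suc sym_pos_def_bfgs_update s_nonzero curvature_pos)
qed

lemma descent_direction: "grad f (x t) \<bullet> s t < 0"
proof -
  have "0 < s t \<bullet> (B t *v s t)"
    using B_sym_pos_def s_nonzero[OF B_sym_pos_def] by (simp add: sym_pos_def_def)
  then show ?thesis
    using step_pos[of t] by (simp add: B_mult_s B_sym_pos_def inner_commute mult_less_0_iff)
qed

lemma r_eq: "r t = L * (grad f (x t) \<bullet> s t)\<^sup>2 / ((norm (grad f (x t)))\<^sup>2 * (s t \<bullet> y t))"
  using step_pos[of t] by (simp add: r_def B_mult_s B_sym_pos_def power_mult_distrib inner_commute)

lemma r_pos: "0 < r t"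
  using descent_direction[of t] grad_nonzero[of t] curvature_pos[OF B_sym_pos_def, of t] L by (simp add: r_eq)

lemma armijo: "f (x (Suc t)) \<le> f (x t) + \<alpha> * (grad f (x t) \<bullet> s t)"
  using aw[of t] seq by (simp add: armijo_wolfe_def bfgs_sequence_def s_eq mult_ac)

lemma wolfe: "(1 - \<beta>) * - (grad f (x t) \<bullet> s t) \<le> s t \<bullet> y t"
proof -
  have "x (Suc t) = x t + \<eta> t *\<^sub>R bfgs_direction f (B t) (x t)"
    using seq by (simp add: bfgs_sequence_def)
  then have "\<beta> * (grad f (x t) \<bullet> bfgs_direction f (B t) (x t))
      \<le> grad f (x (Suc t)) \<bullet> bfgs_direction f (B t) (x t)"
    using aw[of t] by (simp add: armijo_wolfe_def)
  then have "\<eta> t * (\<beta> * (grad f (x t) \<bullet> bfgs_direction f (B t) (x t)))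
      \<le> \<eta> t * (grad f (x (Suc t)) \<bullet> bfgs_direction f (B t) (x t))"
    using step_pos[of t] by (intro mult_left_mono) auto
  then have "\<beta> * (grad f (x t) \<bullet> s t) \<le> grad f (x (Suc t)) \<bullet> s t"
    by (simp add: s_eq mult_ac)
  then show ?thesis
    by (simp add: y_def inner_diff_right inner_commute algebra_simps)
qed

text \<open>No iterate is a minimiser, because the next one has a strictly smaller value.\<close>

lemma gap_pos: "0 < f (x t) - f x_star"
proof -
  have "\<alpha> * (grad f (x t) \<bullet> s t) < 0"
    using \<alpha> descent_direction[of t] by (rule mult_pos_neg)
  then show ?thesis
    using armijo[of t] min[of "x (Suc t)"] by linarith
qed

text \<open>The contraction term is the Armijo decrease \<open>\<alpha> * m\<close> times two ratios that are at most one, by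
  the Wolfe condition and by gradient dominance.\<close>

lemma gap_Suc_le:
  "f (x (Suc t)) - f x_star
    \<le> (1 - 2 * \<alpha> * (1 - \<beta>) / (L / \<mu>) * r t) * (f (x t) - f x_star)"
proof -
  define m where "m = - (grad f (x t) \<bullet> s t)"
  define G where "G = (norm (grad f (x t)))\<^sup>2"
  define \<Delta> where "\<Delta> = f (x t) - f x_star"
  define \<rho> where "\<rho> = s t \<bullet> y t"
  have pos: "0 < m" "0 < G" "0 < \<rho>"
    using descent_direction[of t] grad_nonzero[of t] curvature_pos[OF B_sym_pos_def, of t]
    by (simp_all add: m_def G_def \<rho>_def)
  have r: "r t = L * m\<^sup>2 / (G * \<rho>)"
    by (simp add: r_eq m_def G_def \<rho>_def)
  have dominance: "2 * \<mu> * \<Delta> \<le> G"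
    unfolding \<Delta>_def G_def by (rule strongly_convex_gradient_dominance[OF diff sc \<mu>])
  have curvature: "(1 - \<beta>) * m \<le> \<rho>"
    using wolfe[of t] by (simp add: m_def \<rho>_def)
  have "2 * \<alpha> * (1 - \<beta>) / (L / \<mu>) * r t * \<Delta> = \<alpha> * m * ((1 - \<beta>) * m / \<rho>) * (2 * \<mu> * \<Delta> / G)"
    using L \<mu> pos by (simp add: r flip: \<Delta>_def) (simp add: power2_eq_square mult_ac)
  also have "\<dots> \<le> \<alpha> * m * 1 * 1"
    using pos \<alpha> \<beta> \<mu> dominance curvature gap_pos[of t]
    by (intro mult_mono) (auto simp: \<Delta>_def)
  also have "\<dots> \<le> f (x t) - f (x (Suc t))"
    using armijo[of t] by (simp add: m_def)
  finally show ?thesis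
    by (simp add: \<Delta>_def algebra_simps)
qed

lemma potential_le: "bfgs_potential L (B t) \<le> bfgs_potential L (B 0) + (\<Sum>i<t. ln (r i))"
proof (induction t)
  case (Suc t)
  have "(norm (y t))\<^sup>2 \<le> L * (s t \<bullet> y t)"
    unfolding s_def y_def
  proof (rule convex_lipschitz_gradient_cocoercive[OF diff lip L])
    fix z w :: "real^'n"
    have "0 \<le> \<mu> / 2 * (norm (w - z))\<^sup>2"
      using \<mu> by simp
    then show "f z + grad f z \<bullet> (w - z) \<le> f w"
      using strongly_convex_lower_bound[OF diff sc, of z w] by linarith
  qed
  then have "bfgs_potential L (B (Suc t)) \<le> bfgs_potential L (B t) + ln (r t)"
    unfolding B_Suc r_def using bfgs_potential_ge[OF B_sym_pos_def L]
    by (intro bfgs_potential_update_le B_sym_pos_def s_nonzero curvature_pos L) auto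
  with Suc.IH show ?case
    by simp
qed simp

text \<open>Each factor is nonnegative because it bounds the ratio of two positive gaps from above.\<close>

lemma gap_le_prod:
  "f (x t) - f x_star
    \<le> (\<Prod>i<t. 1 - 2 * \<alpha> * (1 - \<beta>) / (L / \<mu>) * r i) * (f (x 0) - f x_star)"
  and factor_nonneg: "2 * \<alpha> * (1 - \<beta>) / (L / \<mu>) * r t \<le> 1"
proof -
  have nonneg: "2 * \<alpha> * (1 - \<beta>) / (L / \<mu>) * r i \<le> 1" for i
  proof -
    have "0 < (1 - 2 * \<alpha> * (1 - \<beta>) / (L / \<mu>) * r i) * (f (x i) - f x_star)"
      using gap_Suc_le[of i] gap_pos[of "Suc i"] by linarith
    then have "0 < 1 - 2 * \<alpha> * (1 - \<beta>) / (L / \<mu>) * r i"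
      using gap_pos[of i] by (rule zero_less_mult_pos2)
    then show ?thesis
      by linarith
  qed
  then show "2 * \<alpha> * (1 - \<beta>) / (L / \<mu>) * r t \<le> 1" .
  show "f (x t) - f x_star
    \<le> (\<Prod>i<t. 1 - 2 * \<alpha> * (1 - \<beta>) / (L / \<mu>) * r i) * (f (x 0) - f x_star)"
  proof (induction t)
    case (Suc t)
    have "f (x (Suc t)) - f x_star
        \<le> (1 - 2 * \<alpha> * (1 - \<beta>) / (L / \<mu>) * r t) * (f (x t) - f x_star)"
      by (rule gap_Suc_le)
    also have "\<dots> \<le> (1 - 2 * \<alpha> * (1 - \<beta>) / (L / \<mu>) * r t)
        * ((\<Prod>i<t. 1 - 2 * \<alpha> * (1 - \<beta>) / (L / \<mu>) * r i) * (f (x 0) - f x_star))"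
      using nonneg[of t] by (intro mult_left_mono Suc.IH) simp
    finally show ?case
      by (simp add: mult_ac)
  qed simp
qed

text \<open>The constant \<open>K\<close> measures how far the initial matrix is from \<open>L I\<close>; both initialisations are
  instances.\<close>

lemma gap_ratio_le:
  assumes K: "bfgs_potential L (B 0) \<le> bfgs_potential L (L *\<^sub>R mat 1 :: real^'n^'n) + K"
    and t: "1 \<le> t"
  shows "(f (x t) - f x_star) / (f (x 0) - f x_star)
    \<le> (1 - exp (- (K / t)) * (2 * \<alpha> * (1 - \<beta>) / (L / \<mu>))) ^ t"
proof -
  define c where "c = 2 * \<alpha> * (1 - \<beta>) / (L / \<mu>)"
  have "bfgs_potential L (L *\<^sub>R mat 1 :: real^'n^'n) \<le> bfgs_potential L (B t)"
    using bfgs_potential_ge[OF B_sym_pos_def L] by simp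
  then have "- K \<le> (\<Sum>i<t. ln (r i))"
    using potential_le[of t] K by linarith
  moreover have "0 \<le> c"
    using \<alpha> \<beta> L \<mu> by (simp add: c_def)
  ultimately have "(\<Prod>i<t. 1 - c * r i) \<le> (1 - c * exp (- (K / t))) ^ t"
    using t r_pos factor_nonneg by (intro prod_one_minus_le) (auto simp: c_def)
  moreover have "(f (x t) - f x_star) / (f (x 0) - f x_star) \<le> (\<Prod>i<t. 1 - c * r i)"
    using gap_le_prod[of t] gap_pos[of 0] by (simp add: c_def pos_divide_le_eq)
  ultimately show ?thesis
    by (simp add: c_def mult.commute)
qed

end

theorem corollary4p2:
  fixes f :: "real^'n \<Rightarrow> real"
    and x :: "nat \<Rightarrow> real^'n"
    and B :: "nat \<Rightarrow> real^'n^'n"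
    and \<eta> :: "nat \<Rightarrow> real"
    and x_star :: "real^'n"
    and \<mu> L \<kappa> \<alpha> \<beta> :: real
  assumes "twice_differentiable f"
    and "\<mu> > 0" and "strongly_convex \<mu> f"
    and "L > 0" and "L-lipschitz_on UNIV (grad f)"
    and "\<kappa> = L / \<mu>"
    and "is_arg_min f (\<lambda>_. True) x_star"
    and "0 < \<alpha>" and "\<alpha> < \<beta>" and "\<beta> < 1" and "\<alpha> < 1 / 2"
    and "bfgs_sequence f x B \<eta>"
    and "\<forall>t. armijo_wolfe f \<alpha> \<beta> (x t) (bfgs_direction f (B t) (x t)) (\<eta> t)"
  shows "(B 0 = L *\<^sub>R mat 1 \<longrightarrow>
            (\<forall>t\<ge>1. (f (x t) - f x_star) / (f (x 0) - f x_star)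
                      \<le> (1 - 2 * \<alpha> * (1 - \<beta>) / \<kappa>) ^ t)) \<and>
         (B 0 = \<mu> *\<^sub>R mat 1 \<longrightarrow>
            (\<forall>t\<ge>1. (f (x t) - f x_star) / (f (x 0) - f x_star)
                      \<le> (1 - exp (- (real CARD('n) * ln \<kappa> / real t)) * (2 * \<alpha> * (1 - \<beta>) / \<kappa>)) ^ t) \<and>
            (\<forall>t\<ge>1. real t \<ge> real CARD('n) * ln \<kappa> \<longrightarrow>
                      (f (x t) - f x_star) / (f (x 0) - f x_star)
                      \<le> (1 - 2 * \<alpha> * (1 - \<beta>) / (3 * \<kappa>)) ^ t))"
proof -
  have diff: "f differentiable (at z)" for z
    using assms(1) by (simp add: twice_differentiable_def)
  interpret bfgs_armijo_wolfe f x B \<eta> x_star \<mu> L \<alpha> \<beta>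
    using assms diff by unfold_locales (auto simp: is_arg_min_linorder)
  have \<kappa>: "1 \<le> \<kappa>"
    using strong_convexity_le_lipschitz_gradient[OF diff sc lip] \<mu> by (simp add: assms(6))
  define c where "c = 2 * \<alpha> * (1 - \<beta>) / \<kappa>"
  have "2 * \<alpha> * (1 - \<beta>) \<le> 1 * 1"
    using assms by (intro mult_mono) auto
  then have c: "0 \<le> c" "c \<le> 1"
    using \<alpha> \<beta> \<kappa> by (simp_all add: c_def divide_le_eq)
  have "(f (x t) - f x_star) / (f (x 0) - f x_star) \<le> (1 - c) ^ t"
    if "B 0 = L *\<^sub>R mat 1" "1 \<le> t" for t
    using gap_ratio_le[of 0 t] that by (simp add: c_def assms(6))
  moreover have ii: "(f (x t) - f x_star) / (f (x 0) - f x_star)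
      \<le> (1 - exp (- (real CARD('n) * ln \<kappa> / real t)) * c) ^ t"
    if "B 0 = \<mu> *\<^sub>R mat 1" "1 \<le> t" for t
  proof -
    have "\<mu> / L \<le> 1"
      using \<kappa> \<mu> L by (simp add: assms(6))
    then have "\<mu> / L - ln \<mu> \<le> 1 - ln L + ln \<kappa>"
      using \<mu> L by (simp add: assms(6) ln_div)
    then have "CARD('n) * (\<mu> / L - ln \<mu>) \<le> CARD('n) * (1 - ln L + ln \<kappa>)"
      by (intro mult_left_mono) auto
    then have "bfgs_potential L (B 0)
        \<le> bfgs_potential L (L *\<^sub>R mat 1 :: real^'n^'n) + CARD('n) * ln \<kappa>"
      using \<mu> L by (simp add: that(1) bfgs_potential_scaleR_mat_1 algebra_simps)
    from gap_ratio_le[OF this that(2)] show ?thesis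
      by (simp add: c_def assms(6))
  qed
  moreover have "(f (x t) - f x_star) / (f (x 0) - f x_star) \<le> (1 - c / 3) ^ t"
    if "B 0 = \<mu> *\<^sub>R mat 1" "1 \<le> t" "CARD('n) * ln \<kappa> \<le> t" for t
  proof -
    define E where "E = exp (- (CARD('n) * ln \<kappa> / t))"
    have "0 \<le> CARD('n) * ln \<kappa> / t" "CARD('n) * ln \<kappa> / t \<le> 1"
      using \<kappa> that by simp_all
    then have "exp (- 1) \<le> E" "E \<le> 1"
      by (simp_all add: E_def)
    moreover have "1 / 3 \<le> exp (- 1 :: real)"
      using exp_le by (simp add: exp_minus field_simps)
    ultimately have E: "1 / 3 \<le> E" "E \<le> 1" "0 \<le> E"
      unfolding E_def by (linarith, linarith, simp)
    then have "c * (1 / 3) \<le> c * E" "c * E \<le> 1 * 1"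
      using c by (intro mult_left_mono mult_mono; simp)+
    then have "(1 - E * c) ^ t \<le> (1 - c / 3) ^ t"
      by (intro power_mono) (auto simp: mult.commute)
    with ii[OF that(1,2)] show ?thesis
      by (simp add: E_def)
  qed
  ultimately show ?thesis
    by (simp add: c_def mult.commute[of 3])
qed

end
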